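(* Let $n\ge 3$ and $i\in\{1,\dots,n\}$. Every right-handed skew Boolean algebra can be embedded into the skew $i$-reduct $S_i(\mathbf A)=(A,\land_i,\overline\vee_i,\setminus_i,\mathsf e_i)$ of a suitable $n\mathrm{BA}$ $\mathbf A$ of $n$-partitions; that is, for every right-handed skew Boolean algebra $\mathbf S$ there are a set $I$, a subalgebra $\mathbf A$ of $\mathrm{Par}_n(I)$, and an injective homomorphism of skew Boolean algebras from $\mathbf S$ into $S_i(\mathbf A)$.
   Context: A skew lattice is an algebra $(A,\lor,\land)$ with $\lor,\land$ associative and idempotent, satisfying $x\lor(x\land y)=x=x\land(x\lor y)$ and $(y\land x)\lor x=x=(y\lor x)\land x$. A skew Boolean algebra is an algebra $(A,\lor,\land,\setminus,0)$ of type $(2,2,2,0)$ such that: $(A,\lor,\land)$ is a skew lattice satisfying $x\land y\land z\land x=x\land z\land y\land x$, $x\land(y\lor z)=(x\land y)\lor(x\land z)$, $(y\lor z)\land x=(y\land x)\lor(z\land x)$; $0\land x=0=x\land 0$; and $(x\land y\land x)\lor(x\setminus y)=x=(x\setminus y)\lor(x\land y\land x)$, $x\land y\land x\land(x\setminus y)=0=(x\setminus y)\land x\land y\land x$. It is right-handed if $a\land b\land a=b\land a$ for all $a,b$. For a set $I$, an $n$-partition of $I$ is a sequence $(Y_1,\dots,Y_n)$ of pairwise disjoint (possibly empty) subsets of $I$ with union $I$. $\mathrm{Par}_n(I)$ is the algebra of all $n$-partitions of $I$ with the $(n+1)$-ary operation, for $\mathbf y^k=(Y^k_1,\dots,Y^k_n)$,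 $$q(\mathbf y^0,\mathbf y^1,\dots,\mathbf y^n)=\Big(\bigcup_{k=1}^n Y^0_k\cap Y^k_1,\dots,\bigcup_{k=1}^n Y^0_k\cap Y^k_n\Big)$$ and constants $\mathsf e_1=(I,\emptyset,\dots,\emptyset),\dots,\mathsf e_n=(\emptyset,\dots,\emptyset,I)$. An $n\mathrm{BA}$ of $n$-partitions is a subalgebra of some $\mathrm{Par}_n(I)$. For such an algebra $\mathbf A$ with universe $A$ let $t_i(x,y,z)=q(x,w_1,\dots,w_n)$ with $w_i=z$ and $w_k=y$ for $k\ne i$, and define $x\land_i y=t_i(x,y,\mathsf e_i)$, $x\,\overline\vee_i\,y=t_i(x,x,y)$, $y\setminus_i x=t_i(x,\mathsf e_i,y)$. In $S_i(\mathbf A)$ the operation $\overline\vee_i$ plays the role of $\lor$, $\land_i$ of $\land$, $\setminus_i$ of $\setminus$, and $\mathsf e_i$ of $0$. *)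

theory Defs
  imports Main "HOL-Library.FuncSet" "HOL-Library.Disjoint_Sets" "HOL-Algebra.Congruence"
begin

record 'a sba = "'a partial_object" +
  sjoin :: "['a, 'a] \<Rightarrow> 'a" (infixl \<open>\<curlyvee>\<index>\<close> 65)
  smeet :: "['a, 'a] \<Rightarrow> 'a" (infixl \<open>\<curlywedge>\<index>\<close> 70)
  sdiff :: "['a, 'a] \<Rightarrow> 'a" (infixl \<open>\<setminus>\<index>\<close> 70)
  szero :: 'a (\<open>\<zero>\<index>\<close>)

locale skew_lattice =
  fixes S (structure)
  assumes join_closed: "\<lbrakk>x \<in> carrier S; y \<in> carrier S\<rbrakk> \<Longrightarrow> x \<curlyvee> y \<in> carrier S"
    and meet_closed: "\<lbrakk>x \<in> carrier S; y \<in> carrier S\<rbrakk> \<Longrightarrow> x \<curlywedge> y \<in> carrier S"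
    and join_assoc: "\<lbrakk>x \<in> carrier S; y \<in> carrier S; z \<in> carrier S\<rbrakk>
      \<Longrightarrow> (x \<curlyvee> y) \<curlyvee> z = x \<curlyvee> (y \<curlyvee> z)"
    and meet_assoc: "\<lbrakk>x \<in> carrier S; y \<in> carrier S; z \<in> carrier S\<rbrakk>
      \<Longrightarrow> (x \<curlywedge> y) \<curlywedge> z = x \<curlywedge> (y \<curlywedge> z)"
    and join_idem: "x \<in> carrier S \<Longrightarrow> x \<curlyvee> x = x"
    and meet_idem: "x \<in> carrier S \<Longrightarrow> x \<curlywedge> x = x"
    and absorb1: "\<lbrakk>x \<in> carrier S; y \<in> carrier S\<rbrakk> \<Longrightarrow> x \<curlyvee> (x \<curlywedge> y) = x"
    and absorb2: "\<lbrakk>x \<in> carrier S; y \<in> carrier S\<rbrakk> \<Longrightarrow> x \<curlywedge> (x \<curlyvee> y) = x"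
    and absorb3: "\<lbrakk>x \<in> carrier S; y \<in> carrier S\<rbrakk> \<Longrightarrow> (y \<curlywedge> x) \<curlyvee> x = x"
    and absorb4: "\<lbrakk>x \<in> carrier S; y \<in> carrier S\<rbrakk> \<Longrightarrow> (y \<curlyvee> x) \<curlywedge> x = x"

locale skew_boolean_algebra = skew_lattice S for S (structure) +
  assumes diff_closed: "\<lbrakk>x \<in> carrier S; y \<in> carrier S\<rbrakk> \<Longrightarrow> x \<setminus> y \<in> carrier S"
    and zero_closed: "\<zero> \<in> carrier S"
    and normal: "\<lbrakk>x \<in> carrier S; y \<in> carrier S; z \<in> carrier S\<rbrakk>
      \<Longrightarrow> x \<curlywedge> y \<curlywedge> z \<curlywedge> x = x \<curlywedge> z \<curlywedge> y \<curlywedge> x"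
    and distrib_left: "\<lbrakk>x \<in> carrier S; y \<in> carrier S; z \<in> carrier S\<rbrakk>
      \<Longrightarrow> x \<curlywedge> (y \<curlyvee> z) = (x \<curlywedge> y) \<curlyvee> (x \<curlywedge> z)"
    and distrib_right: "\<lbrakk>x \<in> carrier S; y \<in> carrier S; z \<in> carrier S\<rbrakk>
      \<Longrightarrow> (y \<curlyvee> z) \<curlywedge> x = (y \<curlywedge> x) \<curlyvee> (z \<curlywedge> x)"
    and zero_meet: "x \<in> carrier S \<Longrightarrow> \<zero> \<curlywedge> x = \<zero>"
    and meet_zero: "x \<in> carrier S \<Longrightarrow> x \<curlywedge> \<zero> = \<zero>"
    and meet_join_diff: "\<lbrakk>x \<in> carrier S; y \<in> carrier S\<rbrakk> \<Longrightarrow> (x \<curlywedge> y \<curlywedge> x) \<curlyvee> (x \<setminus> y) = x"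
    and diff_join_meet: "\<lbrakk>x \<in> carrier S; y \<in> carrier S\<rbrakk> \<Longrightarrow> (x \<setminus> y) \<curlyvee> (x \<curlywedge> y \<curlywedge> x) = x"
    and meet_meet_diff: "\<lbrakk>x \<in> carrier S; y \<in> carrier S\<rbrakk> \<Longrightarrow> x \<curlywedge> y \<curlywedge> x \<curlywedge> (x \<setminus> y) = \<zero>"
    and diff_meet_meet: "\<lbrakk>x \<in> carrier S; y \<in> carrier S\<rbrakk> \<Longrightarrow> (x \<setminus> y) \<curlywedge> x \<curlywedge> y \<curlywedge> x = \<zero>"

locale right_handed_sba = skew_boolean_algebra S for S (structure) +
  assumes right_handed: "\<lbrakk>x \<in> carrier S; y \<in> carrier S\<rbrakk> \<Longrightarrow> x \<curlywedge> y \<curlywedge> x = y \<curlywedge> x"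

definition sba_hom :: "'a sba \<Rightarrow> 'b sba \<Rightarrow> ('a \<Rightarrow> 'b) set" where
  "sba_hom S T = {h. h \<in> carrier S \<rightarrow> carrier T \<and>
     (\<forall>x\<in>carrier S. \<forall>y\<in>carrier S.
        h (x \<curlyvee>\<^bsub>S\<^esub> y) = h x \<curlyvee>\<^bsub>T\<^esub> h y \<and>
        h (x \<curlywedge>\<^bsub>S\<^esub> y) = h x \<curlywedge>\<^bsub>T\<^esub> h y \<and>
        h (x \<setminus>\<^bsub>S\<^esub> y) = h x \<setminus>\<^bsub>T\<^esub> h y) \<and>
     h \<zero>\<^bsub>S\<^esub> = \<zero>\<^bsub>T\<^esub>}"

text \<open>An \<open>n\<close>-partition \<open>(Y\<^sub>1, \<dots>, Y\<^sub>n)\<close> is a function on \<open>{1..n}\<close>; it is required to be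
  \<open>undefined\<close> outside \<open>{1..n}\<close>, so that HOL equality is equality of sequences.

  HOL cannot quantify over the type of the points of \<open>I\<close>. Taking the points to be pairs of
  elements of the embedded algebra is no restriction: given an embedding \<open>h\<close> into an algebra of
  \<open>n\<close>-partitions of any set \<open>J\<close>, choose for every pair \<open>(a, b)\<close> with \<open>a \<noteq> b\<close> a point of \<open>J\<close>
  at which \<open>h a\<close> and \<open>h b\<close> differ; pulling partitions of \<open>J\<close> back along this choice is a
  homomorphism that stays injective on the image of \<open>h\<close>.\<close>

definition Par :: "nat \<Rightarrow> 'b set \<Rightarrow> (nat \<Rightarrow> 'b set) set" where
  "Par n I = {Y \<in> extensional {1..n}.
     disjoint_family_on Y {1..n} \<and> (\<Union>k\<in>{1..n}. Y k) = I}"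

text \<open>The \<open>n\<close> last arguments of the \<open>(n+1)\<close>-ary operation are given as a family
  \<open>w\<close> of which only the values at \<open>1, \<dots>, n\<close> matter.\<close>

definition par_q :: "nat \<Rightarrow> (nat \<Rightarrow> 'b set) \<Rightarrow> (nat \<Rightarrow> nat \<Rightarrow> 'b set) \<Rightarrow> (nat \<Rightarrow> 'b set)" where
  "par_q n y w = (\<lambda>j\<in>{1..n}. \<Union>k\<in>{1..n}. y k \<inter> w k j)"

definition par_e :: "nat \<Rightarrow> 'b set \<Rightarrow> nat \<Rightarrow> (nat \<Rightarrow> 'b set)" where
  "par_e n I k = (\<lambda>j\<in>{1..n}. if j = k then I else {})"

definition nBA_of_partitions :: "nat \<Rightarrow> 'b set \<Rightarrow> (nat \<Rightarrow> 'b set) set \<Rightarrow> bool" where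
  "nBA_of_partitions n I A \<longleftrightarrow>
     A \<subseteq> Par n I \<and>
     (\<forall>k\<in>{1..n}. par_e n I k \<in> A) \<and>
     (\<forall>y\<in>A. \<forall>w\<in>{1..n} \<rightarrow> A. par_q n y w \<in> A)"

definition par_t ::
  "nat \<Rightarrow> nat \<Rightarrow> (nat \<Rightarrow> 'b set) \<Rightarrow> (nat \<Rightarrow> 'b set) \<Rightarrow> (nat \<Rightarrow> 'b set) \<Rightarrow> (nat \<Rightarrow> 'b set)" where
  "par_t n i x y z = par_q n x (\<lambda>k. if k = i then z else y)"

text \<open>The skew reduct \<open>S\<^sub>i(A)\<close>. Note the order of the arguments of the difference:
  \<open>y \<setminus>\<^sub>i x = t\<^sub>i(x, e\<^sub>i, y)\<close>.\<close>

definition skew_reduct ::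
  "nat \<Rightarrow> nat \<Rightarrow> 'b set \<Rightarrow> (nat \<Rightarrow> 'b set) set \<Rightarrow> (nat \<Rightarrow> 'b set) sba" where
  "skew_reduct n i I A =
    \<lparr> carrier = A,
      sjoin = (\<lambda>x y. par_t n i x x y),
      smeet = (\<lambda>x y. par_t n i x y (par_e n I i)),
      sdiff = (\<lambda>y x. par_t n i x (par_e n I i) y),
      szero = par_e n I i \<rparr>"

end

(* A point of I turns an element of Par_n(I) into an index in {1..n}, and under this reading
   S_i acts on {1..n} as the right-handed primitive skew Boolean algebra with zero i. So it is
   enough to separate any two elements a, b of S by a homomorphism into the primitive algebra
   {i, u, v}, which exists inside {1..n} because n >= 3.

   In the right-handed case p \<curlywedge> x is the restriction of x to the support of p. The set of all p
   with p \<curlywedge> a = p \<curlywedge> b is an ideal, and it misses a or b, say c. An ideal Q that is maximal among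
   the ideals containing it and missing c is prime. Send Q to i, the elements outside Q with the
   germ of c at Q to u, and the other elements to v. *)

theory Submission imports Defs begin

text \<open>The operations have the same case distinction on \<open>x = z\<close> as
  \<open>par_t\<close> has on the index \<open>i\<close>, which makes the comparison in
  \<open>fibres_hom\<close> pointwise. The bound variables of \<open>sdiff\<close> are named as in
  \<open>skew_reduct\<close>: \<open>x\<close> is the element that is subtracted.\<close>

definition primitive_sba :: "'b set \<Rightarrow> 'b \<Rightarrow> 'b sba" where
  "primitive_sba K z =
    \<lparr> carrier = K,
      sjoin = (\<lambda>x y. if x = z then y else x),
      smeet = (\<lambda>x y. if x = z then z else y),
      sdiff = (\<lambda>y x. if x = z then y else z),
      szero = z \<rparr>"

section \<open>Ideals and germs\<close>

context right_handed_sba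
begin

section \<open>Identities of meet and difference in the right-handed case\<close>

lemma meet_left_commute:
  assumes "x \<in> carrier S" "y \<in> carrier S" "z \<in> carrier S"
  shows "x \<curlywedge> (y \<curlywedge> z) = y \<curlywedge> (x \<curlywedge> z)"
proof -
  \<comment> \<open>Right-handedness puts a second \<open>z\<close> in front, so that normality can
    exchange the two factors between the copies of \<open>z\<close>.\<close>
  have "x \<curlywedge> y \<curlywedge> z = z \<curlywedge> (x \<curlywedge> y) \<curlywedge> z"
    using assms by (simp add: right_handed meet_closed)
  also have "\<dots> = z \<curlywedge> (y \<curlywedge> x) \<curlywedge> z"
    using assms normal[of z x y] by (simp add: meet_assoc meet_closed)
  also have "\<dots> = y \<curlywedge> x \<curlywedge> z"
    using assms by (simp add: right_handed meet_closed)
  finally show ?thesis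
    using assms by (simp add: meet_assoc)
qed

lemma zero_join: "x \<in> carrier S \<Longrightarrow> \<zero> \<curlyvee> x = x"
  using absorb3[of x \<zero>] by (simp add: zero_meet zero_closed)

lemma meet_join_diff': "\<lbrakk>x \<in> carrier S; y \<in> carrier S\<rbrakk> \<Longrightarrow> (y \<curlywedge> x) \<curlyvee> (x \<setminus> y) = x"
  using meet_join_diff[of x y] by (simp add: right_handed)

lemma meet_diff: "\<lbrakk>x \<in> carrier S; y \<in> carrier S\<rbrakk> \<Longrightarrow> x \<curlywedge> (x \<setminus> y) = x \<setminus> y"
  using absorb4[of "x \<setminus> y" "y \<curlywedge> x"] by (simp add: meet_join_diff' meet_closed diff_closed)

text \<open>The axioms only say that \<open>x \<setminus> y\<close> annihilates
  \<open>x \<curlywedge> y \<curlywedge> x\<close>. The missing \<open>x\<close> comes from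
  \<open>meet_diff\<close> and is carried past the difference by left commutation.\<close>

lemma diff_meet_zero:
  assumes "x \<in> carrier S" "y \<in> carrier S"
  shows "(x \<setminus> y) \<curlywedge> y = \<zero>"
proof -
  let ?p = "x \<setminus> y"
  have p: "?p \<in> carrier S"
    using assms by (rule diff_closed)
  have "?p \<curlywedge> (y \<curlywedge> x) = ?p \<curlywedge> (x \<curlywedge> y \<curlywedge> x)"
    using assms by (simp add: right_handed)
  also have "\<dots> = \<zero>"
    using assms p diff_meet_meet[of x y] by (simp add: meet_assoc meet_closed)
  finally have zero: "?p \<curlywedge> (y \<curlywedge> x) = \<zero>" .
  have "?p \<curlywedge> y = x \<curlywedge> ?p \<curlywedge> y"
    using assms by (simp add: meet_diff)
  also have "\<dots> = ?p \<curlywedge> (x \<curlywedge> y)"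
    using assms p by (simp add: meet_assoc meet_left_commute)
  also have "\<dots> = ?p \<curlywedge> (y \<curlywedge> x \<curlywedge> y)"
    using assms by (simp add: right_handed)
  also have "\<dots> = ?p \<curlywedge> (y \<curlywedge> x) \<curlywedge> y"
    using assms p by (simp add: meet_assoc meet_closed)
  also have "\<dots> = \<zero>"
    using assms zero by (simp add: zero_meet)
  finally show ?thesis .
qed

text \<open>Decompose the second factor as
  \<open>(y \<curlywedge> x) \<curlyvee> (x \<setminus> y)\<close> and distribute: the first summand
  vanishes by \<open>diff_meet_zero\<close>.\<close>

lemma diff_meet_self:
  assumes "x \<in> carrier S" "y \<in> carrier S"
  shows "(x \<setminus> y) \<curlywedge> x = x \<setminus> y"
proof -
  let ?p = "x \<setminus> y"
  have p: "?p \<in> carrier S"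
    using assms by (rule diff_closed)
  have "?p \<curlywedge> x = ?p \<curlywedge> ((y \<curlywedge> x) \<curlyvee> ?p)"
    using assms by (simp add: meet_join_diff')
  also have "\<dots> = (?p \<curlywedge> y \<curlywedge> x) \<curlyvee> ?p"
    using assms p by (simp add: distrib_left meet_closed meet_idem meet_assoc)
  also have "\<dots> = ?p"
    using assms p by (simp add: diff_meet_zero zero_meet zero_join)
  finally show ?thesis .
qed

section \<open>Ideals, and prime ideals obtained from maximality\<close>

definition sba_ideal :: "'a set \<Rightarrow> bool" where
  "sba_ideal Q \<longleftrightarrow> Q \<subseteq> carrier S \<and> \<zero> \<in> Q \<and>
     (\<forall>x\<in>Q. \<forall>y\<in>Q. x \<curlyvee> y \<in> Q) \<and>
     (\<forall>x\<in>Q. \<forall>y\<in>carrier S. x \<curlywedge> y \<in> Q \<and> y \<curlywedge> x \<in> Q)"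

text \<open>These are the supports on which \<open>a\<close> and \<open>b\<close> agree. For
  \<open>p \<curlywedge> y\<close>, left commutation moves \<open>y\<close> to the front, where it
  multiplies the equation for \<open>p\<close>; joins use right distributivity.\<close>

lemma sba_ideal_equalizer:
  assumes "a \<in> carrier S" "b \<in> carrier S"
  shows "sba_ideal {p \<in> carrier S. p \<curlywedge> a = p \<curlywedge> b}"
  unfolding sba_ideal_def
proof (intro conjI ballI)
  fix p y assume p: "p \<in> {p \<in> carrier S. p \<curlywedge> a = p \<curlywedge> b}" and y: "y \<in> carrier S"
  then have "y \<curlywedge> (p \<curlywedge> a) = y \<curlywedge> (p \<curlywedge> b)"
    by simp
  moreover from this have "p \<curlywedge> (y \<curlywedge> a) = p \<curlywedge> (y \<curlywedge> b)"
    using p y assms meet_left_commute[of p y a] meet_left_commute[of p y b] by simp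
  ultimately show "p \<curlywedge> y \<in> {p \<in> carrier S. p \<curlywedge> a = p \<curlywedge> b}"
    "y \<curlywedge> p \<in> {p \<in> carrier S. p \<curlywedge> a = p \<curlywedge> b}"
    using p y assms by (simp_all add: meet_closed meet_assoc)
qed (use assms in \<open>auto simp: zero_closed zero_meet join_closed distrib_right\<close>)

text \<open>The ideal quotient of \<open>Q\<close> by \<open>x\<close> serves to enlarge
  \<open>Q\<close>: it contains \<open>Q\<close>, so a maximality property of \<open>Q\<close> can
  be tested on it.\<close>

lemma sba_ideal_quotient:
  assumes "sba_ideal Q" "x \<in> carrier S"
  shows "sba_ideal {s \<in> carrier S. x \<curlywedge> s \<in> Q}"
  unfolding sba_ideal_def
proof (intro conjI ballI)
  fix s y assume s: "s \<in> {s \<in> carrier S. x \<curlywedge> s \<in> Q}" and y: "y \<in> carrier S"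
  then have "x \<curlywedge> s \<curlywedge> y \<in> Q" "y \<curlywedge> (x \<curlywedge> s) \<in> Q"
    using assms(1) by (auto simp: sba_ideal_def)
  then show "s \<curlywedge> y \<in> {s \<in> carrier S. x \<curlywedge> s \<in> Q}" "y \<curlywedge> s \<in> {s \<in> carrier S. x \<curlywedge> s \<in> Q}"
    using s y assms(2) by (simp_all add: meet_closed meet_assoc meet_left_commute)
qed (use assms in \<open>auto simp: sba_ideal_def zero_closed meet_zero join_closed distrib_left\<close>)

lemma sba_ideal_Union_chain:
  assumes "C \<noteq> {}" "\<And>Q. Q \<in> C \<Longrightarrow> sba_ideal Q" "\<And>Q R. \<lbrakk>Q \<in> C; R \<in> C\<rbrakk> \<Longrightarrow> Q \<subseteq> R \<or> R \<subseteq> Q"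
  shows "sba_ideal (\<Union>C)"
  unfolding sba_ideal_def
proof (intro conjI ballI)
  fix x y assume "x \<in> \<Union>C" "y \<in> \<Union>C"
  then obtain Q R where "x \<in> Q" "Q \<in> C" "y \<in> R" "R \<in> C" by blast
  then obtain T where "x \<in> T" "y \<in> T" "T \<in> C"
    using assms(3) by blast
  then show "x \<curlyvee> y \<in> \<Union>C"
    using assms(2) unfolding sba_ideal_def by blast
qed (use assms(1,2) in \<open>(fastforce simp: sba_ideal_def)+\<close>)

lemma prime_ideal_exists:
  assumes J: "sba_ideal J" and c: "c \<in> carrier S" "c \<notin> J"
  obtains Q where "sba_ideal Q" "J \<subseteq> Q" "c \<notin> Q"
    "\<And>x y. \<lbrakk>x \<in> carrier S; y \<in> carrier S; x \<curlywedge> y \<in> Q\<rbrakk> \<Longrightarrow> x \<in> Q \<or> y \<in> Q"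
proof -
  let ?F = "{Q. sba_ideal Q \<and> J \<subseteq> Q \<and> c \<notin> Q}"
  have "\<exists>Q\<in>?F. \<forall>X\<in>?F. Q \<subseteq> X \<longrightarrow> X = Q"
  proof (rule subset_Zorn_nonempty)
    fix C assume C: "C \<noteq> {}" "subset.chain ?F C"
    then have "sba_ideal (\<Union>C)"
      by (intro sba_ideal_Union_chain) (auto simp: subset_chain_def)
    then show "\<Union>C \<in> ?F"
      using C by (auto simp: subset_chain_def)
  qed (use J c in blast)
  then obtain Q where Q: "sba_ideal Q" "J \<subseteq> Q" "c \<notin> Q"
    and max: "\<And>X. \<lbrakk>sba_ideal X; J \<subseteq> X; c \<notin> X; Q \<subseteq> X\<rbrakk> \<Longrightarrow> X = Q"
    by auto
  \<comment> \<open>The quotient by such an \<open>x\<close> still omits \<open>c\<close>, so by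
    maximality it cannot be larger than \<open>Q\<close>.\<close>
  have quotient: "{s \<in> carrier S. x \<curlywedge> s \<in> Q} = Q" if "x \<in> carrier S" "x \<curlywedge> c \<notin> Q" for x
  proof -
    have "Q \<subseteq> {s \<in> carrier S. x \<curlywedge> s \<in> Q}"
      using Q(1) that(1) by (auto simp: sba_ideal_def)
    then show ?thesis
      using Q that by (intro max sba_ideal_quotient) auto
  qed
  have "x \<in> Q \<or> y \<in> Q" if "x \<in> carrier S" "y \<in> carrier S" "x \<curlywedge> y \<in> Q" for x y
  proof (rule disjCI)
    \<comment> \<open>Now \<open>y\<close> lies in the quotient by \<open>x\<close> but not in
      \<open>Q\<close>, which forces \<open>x \<curlywedge> c \<in> Q\<close>. Hence
      \<open>c \<curlywedge> x \<in> Q\<close>, and the quotient by \<open>c\<close> is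
      \<open>Q\<close> itself because \<open>c \<curlywedge> c = c\<close> is outside
      \<open>Q\<close>.\<close>
    assume "y \<notin> Q"
    then have "x \<curlywedge> c \<in> Q"
      using quotient[of x] that by blast
    then have "x \<curlywedge> c \<curlywedge> x \<in> Q"
      using Q(1) that by (simp add: sba_ideal_def)
    then have "c \<curlywedge> x \<in> Q"
      using c that by (simp add: right_handed)
    then show "x \<in> Q"
      using quotient[of c] c Q that by (auto simp: meet_idem)
  qed
  then show thesis
    using that Q by blast
qed

end

section \<open>Separating homomorphisms\<close>

lemma germ_hom:
  fixes S :: "'a sba" (structure) and z u v :: 'b
  assumes S: "right_handed_sba S"
    and Q: "right_handed_sba.sba_ideal S Q"
    and prime: "\<And>x y. \<lbrakk>x \<in> carrier S; y \<in> carrier S; x \<curlywedge> y \<in> Q\<rbrakk> \<Longrightarrow> x \<in> Q \<or> y \<in> Q"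
    and c: "c \<in> carrier S"
    and K: "z \<in> K" "u \<in> K" "v \<in> K" "u \<noteq> z" "v \<noteq> z"
  defines "\<phi> \<equiv> (\<lambda>x. if x \<in> Q then z
                     else if \<exists>p\<in>carrier S - Q. p \<curlywedge> x = p \<curlywedge> c then u else v)"
  shows "\<phi> \<in> sba_hom S (primitive_sba K z)"
proof -
  interpret right_handed_sba S by (rule S)
  note closed = meet_closed join_closed diff_closed zero_closed
  have Q_meet: "x \<curlywedge> y \<in> Q \<longleftrightarrow> x \<in> Q \<or> y \<in> Q" if "x \<in> carrier S" "y \<in> carrier S" for x y
    using Q prime that by (auto simp: sba_ideal_def)
  have Q_join: "x \<curlyvee> y \<in> Q \<longleftrightarrow> x \<in> Q \<and> y \<in> Q" if "x \<in> carrier S" "y \<in> carrier S" for x y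
  proof
    assume "x \<curlyvee> y \<in> Q"
    then show "x \<in> Q \<and> y \<in> Q"
      using Q_meet[of x "x \<curlyvee> y"] Q_meet[of "x \<curlyvee> y" y] that
      by (simp add: closed absorb2 absorb4)
  qed (use Q in \<open>auto simp: sba_ideal_def\<close>)
  have zero: "\<zero> \<in> Q"
    using Q by (simp add: sba_ideal_def)
  \<comment> \<open>Since \<open>(x \<setminus> y) \<curlywedge> y\<close> is zero, primality puts
    one of the two factors in \<open>Q\<close>. If both are in \<open>Q\<close>, then so is
    \<open>x\<close>, being the join of \<open>y \<curlywedge> x\<close> and
    \<open>x \<setminus> y\<close>.\<close>
  have Q_diff: "x \<setminus> y \<in> Q \<longleftrightarrow> x \<in> Q \<or> y \<notin> Q" if "x \<in> carrier S" "y \<in> carrier S" for x y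
    using that zero Q_meet[of "x \<setminus> y" y] Q_meet[of x "x \<setminus> y"] Q_join[of "y \<curlywedge> x" "x \<setminus> y"]
    by (auto simp: closed diff_meet_zero meet_diff meet_join_diff' Q_meet)
  \<comment> \<open>Transitivity of having the same germ: the meet of the two witnesses is again a
    witness, and it stays outside \<open>Q\<close> by primality.\<close>
  have germ_imp: "\<exists>r\<in>carrier S - Q. r \<curlywedge> y = r \<curlywedge> c"
    if "x \<in> carrier S" "y \<in> carrier S" "p \<in> carrier S - Q" "p \<curlywedge> x = p \<curlywedge> y"
      and germ: "\<exists>q\<in>carrier S - Q. q \<curlywedge> x = q \<curlywedge> c" for x y p
  proof -
    obtain q where q: "q \<in> carrier S - Q" "q \<curlywedge> x = q \<curlywedge> c"
      using germ by blast
    have "(p \<curlywedge> q) \<curlywedge> y = q \<curlywedge> (p \<curlywedge> x)"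
      using that q by (simp add: meet_assoc meet_left_commute)
    also have "\<dots> = p \<curlywedge> (q \<curlywedge> x)"
      using that(1,3) q(1) by (intro meet_left_commute) auto
    also have "\<dots> = (p \<curlywedge> q) \<curlywedge> c"
      using that(3) q c by (simp add: meet_assoc)
    finally show ?thesis
      using that q by (intro bexI[of _ "p \<curlywedge> q"]) (auto simp: closed Q_meet)
  qed
  \<comment> \<open>Outside \<open>Q\<close> the value of \<open>\<phi>\<close> depends only on the
    germ. Each operation is thereby reduced to naming one \<open>p\<close> outside \<open>Q\<close>
    on which two elements agree.\<close>
  have \<phi>_eqI: "\<phi> x = \<phi> y"
    if "x \<in> carrier S" "y \<in> carrier S" "x \<notin> Q" "y \<notin> Q" "p \<in> carrier S" "p \<notin> Q"
      "p \<curlywedge> x = p \<curlywedge> y" for x y p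
    using that germ_imp[of x y p] germ_imp[of y x p] unfolding \<phi>_def by auto
  have \<phi>_zero: "\<phi> x = z \<longleftrightarrow> x \<in> Q" for x
    using K by (simp add: \<phi>_def)
  have meet: "\<phi> (x \<curlywedge> y) = (if \<phi> x = z then z else \<phi> y)"
    if "x \<in> carrier S" "y \<in> carrier S" for x y
  proof (cases "x \<in> Q \<or> y \<in> Q")
    case True
    then show ?thesis
      using Q_meet[of x y] \<phi>_zero[of x] \<phi>_zero[of y] \<phi>_zero[of "x \<curlywedge> y"] that by auto
  next
    case False
    then have "\<phi> (x \<curlywedge> y) = \<phi> y"
      using that by (intro \<phi>_eqI[of _ _ x])
        (simp_all add: closed Q_meet meet_assoc[symmetric] meet_idem)
    then show ?thesis
      using False by (simp add: \<phi>_zero)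
  qed
  have join: "\<phi> (x \<curlyvee> y) = (if \<phi> x = z then \<phi> y else \<phi> x)"
    if "x \<in> carrier S" "y \<in> carrier S" for x y
  proof (cases "x \<in> Q")
    case False
    then have "\<phi> (x \<curlyvee> y) = \<phi> x"
      using that by (intro \<phi>_eqI[of _ _ x])
        (simp_all add: closed Q_join absorb2 meet_idem)
    then show ?thesis
      using False by (simp add: \<phi>_zero)
  next
    case True
    have "\<phi> (x \<curlyvee> y) = \<phi> y"
    proof (cases "y \<in> Q")
      case True
      then show ?thesis
        using \<open>x \<in> Q\<close> Q_join[of x y] \<phi>_zero[of y] \<phi>_zero[of "x \<curlyvee> y"] that by simp
    next
      case False
      \<comment> \<open>The witness \<open>y \<setminus> x\<close> annihilates \<open>x\<close>, so
        on it the join reduces to \<open>y\<close>; it is outside \<open>Q\<close> because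
        \<open>x\<close> is inside and \<open>y\<close> is not.\<close>
      then show ?thesis
        using \<open>x \<in> Q\<close> that by (intro \<phi>_eqI[of _ _ "y \<setminus> x"])
          (simp_all add: closed Q_join Q_diff distrib_left diff_meet_zero zero_join)
    qed
    then show ?thesis
      using True by (simp add: \<phi>_zero)
  qed
  have diff: "\<phi> (y \<setminus> x) = (if \<phi> x = z then \<phi> y else z)"
    if "x \<in> carrier S" "y \<in> carrier S" for x y
  proof (cases "x \<in> Q \<and> y \<notin> Q")
    case False
    then show ?thesis
      using Q_diff[of y x] \<phi>_zero[of x] \<phi>_zero[of y] \<phi>_zero[of "y \<setminus> x"] that by auto
  next
    case True
    then have "\<phi> (y \<setminus> x) = \<phi> y"
      using that by (intro \<phi>_eqI[of _ _ "y \<setminus> x"])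
        (simp_all add: closed Q_diff meet_idem diff_meet_self)
    then show ?thesis
      using True by (simp add: \<phi>_zero)
  qed
  have "\<phi> \<in> carrier S \<rightarrow> K"
    using K by (auto simp: \<phi>_def)
  then show ?thesis
    using meet join diff zero by (simp add: sba_hom_def primitive_sba_def \<phi>_zero)
qed

lemma separating_hom:
  fixes S :: "'a sba" (structure) and z u v :: 'b
  assumes S: "right_handed_sba S"
    and ab: "a \<in> carrier S" "b \<in> carrier S" "a \<noteq> b"
    and K: "z \<in> K" "u \<in> K" "v \<in> K" "u \<noteq> z" "v \<noteq> z" "u \<noteq> v"
  shows "\<exists>\<phi>\<in>sba_hom S (primitive_sba K z). \<phi> a \<noteq> \<phi> b"
proof -
  interpret right_handed_sba S by (rule S)
  define J where "J = {p \<in> carrier S. p \<curlywedge> a = p \<curlywedge> b}"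
  \<comment> \<open>Otherwise \<open>a \<curlywedge> b = a\<close> and
    \<open>b \<curlywedge> a = b\<close>, and right-handedness turns
    \<open>a \<curlywedge> b \<curlywedge> a = b \<curlywedge> a\<close> into
    \<open>a = b\<close>.\<close>
  have "a \<notin> J \<or> b \<notin> J"
  proof (rule ccontr)
    assume "\<not> (a \<notin> J \<or> b \<notin> J)"
    then have "a \<curlywedge> b = a" "b \<curlywedge> a = b"
      using ab by (auto simp: J_def meet_idem)
    then show False
      using right_handed[of a b] ab by (simp add: meet_idem)
  qed
  then obtain c d where cd: "{c, d} = {a, b}" "c \<notin> J"
    by blast
  have c: "c \<in> carrier S"
    using cd ab by auto
  have "sba_ideal J"
    unfolding J_def using ab(1,2) by (rule sba_ideal_equalizer)
  then obtain Q where Q: "sba_ideal Q" "J \<subseteq> Q" "c \<notin> Q"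
    and prime: "\<And>x y. \<lbrakk>x \<in> carrier S; y \<in> carrier S; x \<curlywedge> y \<in> Q\<rbrakk> \<Longrightarrow> x \<in> Q \<or> y \<in> Q"
    using prime_ideal_exists[OF _ c cd(2)] by blast
  define \<phi> where "\<phi> = (\<lambda>x. if x \<in> Q then z
                     else if \<exists>p\<in>carrier S - Q. p \<curlywedge> x = p \<curlywedge> c then u else v)"
  have "\<phi> \<in> sba_hom S (primitive_sba K z)"
    unfolding \<phi>_def using germ_hom[OF S Q(1) prime c K(1-5)] .
  \<comment> \<open>Such a \<open>p\<close> would lie in \<open>J\<close>, hence in
    \<open>Q\<close>. The element \<open>d\<close> itself may be in \<open>Q\<close>, so its value
    is \<open>z\<close> or \<open>v\<close>; both differ from \<open>u\<close>.\<close>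
  moreover have "\<not> (\<exists>p\<in>carrier S - Q. p \<curlywedge> d = p \<curlywedge> c)"
    using cd(1) Q(2) unfolding J_def by (auto simp: doubleton_eq_iff)
  then have "\<phi> c = u" "\<phi> d \<noteq> u"
    using Q(3) c K by (auto simp: \<phi>_def)
  then have "\<phi> a \<noteq> \<phi> b"
    using cd(1) by (auto simp: doubleton_eq_iff)
  ultimately show ?thesis
    by blast
qed

section \<open>Partitions as functions\<close>

text \<open>Replaces a partition by its index function, for which the operations become pointwise.
  The restriction to \<open>{1..n}\<close> matches the \<open>extensional\<close> condition in
  \<open>Par\<close>.\<close>

definition fibres :: "nat \<Rightarrow> 'b set \<Rightarrow> ('b \<Rightarrow> nat) \<Rightarrow> nat \<Rightarrow> 'b set" where
  "fibres n I f = (\<lambda>j\<in>{1..n}. {p \<in> I. f p = j})"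

lemma fibres_in_Par: "f \<in> I \<rightarrow> {1..n} \<Longrightarrow> fibres n I f \<in> Par n I"
  by (fastforce simp: Par_def fibres_def disjoint_family_on_def)

lemma fibres_cong: "(\<And>p. p \<in> I \<Longrightarrow> f p = g p) \<Longrightarrow> fibres n I f = fibres n I g"
  by (auto simp: fibres_def fun_eq_iff restrict_def)

lemma fibres_eqD:
  assumes "fibres n I f = fibres n I g" "f \<in> I \<rightarrow> {1..n}" "p \<in> I"
  shows "f p = g p"
proof -
  have "p \<in> fibres n I f (f p)" "f p \<in> {1..n}"
    using assms(2,3) by (auto simp: fibres_def)
  then show ?thesis
    unfolding assms(1) by (simp add: fibres_def)
qed

lemma Par_imp_fibres:
  assumes "Y \<in> Par n I"
  shows "\<exists>f\<in>I \<rightarrow> {1..n}. Y = fibres n I f"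
proof -
  have Y: "Y \<in> extensional {1..n}" "disjoint_family_on Y {1..n}" "(\<Union>k\<in>{1..n}. Y k) = I"
    using assms by (auto simp: Par_def)
  then have "\<forall>p\<in>I. \<exists>k\<in>{1..n}. p \<in> Y k"
    by blast
  then obtain f where f: "\<And>p. p \<in> I \<Longrightarrow> f p \<in> {1..n} \<and> p \<in> Y (f p)"
    by metis
  have "Y j = {p \<in> I. f p = j}" if "j \<in> {1..n}" for j
    using Y(2,3) f that by (fastforce simp: disjoint_family_on_def)
  then have "Y = fibres n I f"
    using Y(1) by (intro extensionalityI[of _ "{1..n}"]) (auto simp: fibres_def)
  moreover have "f \<in> I \<rightarrow> {1..n}"
    using f by (intro Pi_I) simp
  ultimately show ?thesis
    by (rule rev_bexI[rotated])
qed

lemma par_q_cong: "(\<And>k. k \<in> {1..n} \<Longrightarrow> w k = w' k) \<Longrightarrow> par_q n y w = par_q n y w'"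
  by (simp add: par_q_def)

text \<open>A point \<open>p\<close> of \<open>I\<close> lies only in the block numbered
  \<open>f p\<close> of the first argument, so only the term \<open>k = f p\<close> of the union can
  contain it.\<close>

lemma par_q_fibres:
  assumes "f \<in> I \<rightarrow> {1..n}"
  shows "par_q n (fibres n I f) (\<lambda>k. fibres n I (g k)) = fibres n I (\<lambda>p. g (f p) p)"
  using assms by (fastforce simp: par_q_def fibres_def fun_eq_iff restrict_def)

lemma par_e_eq_fibres: "par_e n I k = fibres n I (\<lambda>_. k)"
  by (auto simp: par_e_def fibres_def fun_eq_iff)

lemma par_t_fibres:
  assumes "f \<in> I \<rightarrow> {1..n}"
  shows "par_t n i (fibres n I f) (fibres n I g) (fibres n I h) =
    fibres n I (\<lambda>p. if f p = i then h p else g p)"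
proof -
  have "par_t n i (fibres n I f) (fibres n I g) (fibres n I h) =
      par_q n (fibres n I f) (\<lambda>k. fibres n I (if k = i then h else g))"
    unfolding par_t_def by (rule par_q_cong) simp
  also have "\<dots> = fibres n I (\<lambda>p. (if f p = i then h else g) p)"
    using assms by (rule par_q_fibres)
  also have "\<dots> = fibres n I (\<lambda>p. if f p = i then h p else g p)"
    by (rule fibres_cong) simp
  finally show ?thesis .
qed

lemma nBA_Par: "nBA_of_partitions n I (Par n I)"
  unfolding nBA_of_partitions_def
proof (intro conjI ballI)
  fix k assume "k \<in> {1..n}"
  then show "par_e n I k \<in> Par n I"
    unfolding par_e_eq_fibres by (intro fibres_in_Par) simp
next
  fix y w assume y: "y \<in> Par n I" and w: "w \<in> {1..n} \<rightarrow> Par n I"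
  obtain f where f: "f \<in> I \<rightarrow> {1..n}" "y = fibres n I f"
    using Par_imp_fibres[OF y] by (elim bexE)
  have "\<forall>k\<in>{1..n}. \<exists>g. g \<in> I \<rightarrow> {1..n} \<and> w k = fibres n I g"
    using Par_imp_fibres[OF Pi_mem[OF w]] by (simp only: Bex_def) simp
  from bchoice[OF this] obtain g
    where g: "\<forall>k\<in>{1..n}. g k \<in> I \<rightarrow> {1..n} \<and> w k = fibres n I (g k)"
    by (elim exE)
  have "par_q n y w = par_q n y (\<lambda>k. fibres n I (g k))"
    using g by (intro par_q_cong) simp
  also have "\<dots> = fibres n I (\<lambda>p. g (f p) p)"
    using f by (simp add: par_q_fibres)
  also have "\<dots> \<in> Par n I"
  proof (intro fibres_in_Par Pi_I)
    fix p assume p: "p \<in> I"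
    then have "f p \<in> {1..n}"
      using f(1) by (rule Pi_mem[rotated])
    then have "g (f p) \<in> I \<rightarrow> {1..n}"
      using g by simp
    then show "g (f p) p \<in> {1..n}"
      using p by (rule Pi_mem)
  qed
  finally show "par_q n y w \<in> Par n I" .
qed simp

section \<open>Gluing separating homomorphisms into one embedding\<close>

lemma primitive_hom_range:
  assumes "\<phi> \<in> sba_hom S (primitive_sba K z)" "x \<in> carrier S"
  shows "\<phi> x \<in> K"
  using assms by (auto simp: sba_hom_def primitive_sba_def)

text \<open>By \<open>par_t_fibres\<close>, each operation of the skew reduct acts at every point as
  the operation of the primitive algebra on \<open>{1..n}\<close> with zero \<open>i\<close>. A
  family of homomorphisms indexed by the points therefore combines into one.\<close>

lemma fibres_hom:
  assumes \<phi>: "\<And>p. p \<in> I \<Longrightarrow> \<phi> p \<in> sba_hom S (primitive_sba {1..n} i)"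
  shows "(\<lambda>x. fibres n I (\<lambda>p. \<phi> p x)) \<in> sba_hom S (skew_reduct n i I (Par n I))"
proof -
  have range: "(\<lambda>p. \<phi> p x) \<in> I \<rightarrow> {1..n}" if "x \<in> carrier S" for x
    by (intro Pi_I primitive_hom_range[OF \<phi> that])
  have "fibres n I (\<lambda>p. \<phi> p (x \<curlyvee>\<^bsub>S\<^esub> y)) =
        fibres n I (\<lambda>p. if \<phi> p x = i then \<phi> p y else \<phi> p x)"
    and "fibres n I (\<lambda>p. \<phi> p (x \<curlywedge>\<^bsub>S\<^esub> y)) =
        fibres n I (\<lambda>p. if \<phi> p x = i then i else \<phi> p y)"
    and "fibres n I (\<lambda>p. \<phi> p (x \<setminus>\<^bsub>S\<^esub> y)) =
        fibres n I (\<lambda>p. if \<phi> p y = i then \<phi> p x else i)"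
    if "x \<in> carrier S" "y \<in> carrier S" for x y
    using \<phi> that by (auto intro!: fibres_cong simp: sba_hom_def primitive_sba_def)
  moreover have "fibres n I (\<lambda>p. \<phi> p \<zero>\<^bsub>S\<^esub>) = fibres n I (\<lambda>_. i)"
    using \<phi> by (auto intro!: fibres_cong simp: sba_hom_def primitive_sba_def)
  ultimately show ?thesis
    using range
    by (simp add: sba_hom_def skew_reduct_def par_e_eq_fibres par_t_fibres fibres_in_Par)
qed

theorem theorem4p10:
  fixes n i :: nat and S :: "'a sba"
  assumes "n \<ge> 3" and "i \<in> {1..n}" and "right_handed_sba S"
  shows "\<exists>(I :: ('a \<times> 'a) set) A h.
           nBA_of_partitions n I A \<and>
           h \<in> sba_hom S (skew_reduct n i I A) \<and>
           inj_on h (carrier S)"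
proof -
  \<comment> \<open>From \<open>n \<ge> 3\<close> there are two distinct indices other than
    \<open>i\<close>, the nonzero values \<open>u\<close> and \<open>v\<close> of the separating
    homomorphisms.\<close>
  have "card ({1..n} - {i}) \<ge> 2"
    using assms(1,2) by simp
  then obtain u v where uv: "u \<in> {1..n} - {i}" "v \<in> {1..n} - {i}" "u \<noteq> v"
    by (metis card_le_Suc0_iff_eq finite_Diff finite_atLeastAtMost not_less_eq_eq numeral_2_eq_2)
  \<comment> \<open>One point for each pair to be separated, carrying its own homomorphism. If
    \<open>S\<close> has a single element, \<open>I\<close> is empty and \<open>Par n I\<close>
    consists of one partition.\<close>
  define I where "I = {(a, b). a \<in> carrier S \<and> b \<in> carrier S \<and> a \<noteq> b}"
  have "\<exists>\<phi>. \<phi> \<in> sba_hom S (primitive_sba {1..n} i) \<and> \<phi> (fst p) \<noteq> \<phi> (snd p)"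
    if "p \<in> I" for p
    using that separating_hom[OF assms(3), of "fst p" "snd p" i "{1..n}" u v] assms(2) uv
    unfolding I_def by (simp add: Bex_def case_prod_unfold)
  then obtain \<phi> where \<phi>: "\<And>p. p \<in> I \<Longrightarrow> \<phi> p \<in> sba_hom S (primitive_sba {1..n} i)"
    and sep: "\<And>p. p \<in> I \<Longrightarrow> \<phi> p (fst p) \<noteq> \<phi> p (snd p)"
    by metis
  have "inj_on (\<lambda>x. fibres n I (\<lambda>p. \<phi> p x)) (carrier S)"
  proof (rule inj_onI, rule ccontr)
    fix a b assume ab: "a \<in> carrier S" "b \<in> carrier S" "a \<noteq> b"
      and eq: "fibres n I (\<lambda>p. \<phi> p a) = fibres n I (\<lambda>p. \<phi> p b)"
    have p: "(a, b) \<in> I"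
      using ab by (simp add: I_def)
    have "(\<lambda>p. \<phi> p a) \<in> I \<rightarrow> {1..n}"
      by (intro Pi_I primitive_hom_range[OF \<phi> ab(1)])
    from fibres_eqD[OF eq this p] have "\<phi> (a, b) a = \<phi> (a, b) b" .
    then show False
      using sep[OF p] by simp
  qed
  then show ?thesis
    using nBA_Par fibres_hom[of I \<phi> S n i, OF \<phi>] by blast
qed

end
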